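(* Let $n\in\mathbb{N}$. Then $$N_{(1,10)}(n)=8\sigma(n)-32\sigma(\tfrac n4)+8\sigma(\tfrac n{10})-32\sigma(\tfrac n{40})+64W_{(1,10)}(n)+1024W_{(1,10)}(\tfrac n4)-256\bigl(W_{(2,5)}(\tfrac n2)+W_{(1,40)}(n)\bigr),$$ $$N_{(2,5)}(n)=8\sigma(\tfrac n2)-32\sigma(\tfrac n8)+8\sigma(\tfrac n5)-32\sigma(\tfrac n{20})+64W_{(2,5)}(n)+1024W_{(2,5)}(\tfrac n4)-256\bigl(W_{(5,8)}(n)+W_{(1,10)}(\tfrac n2)\bigr),$$ $$N_{(1,14)}(n)=8\sigma(n)-32\sigma(\tfrac n4)+8\sigma(\tfrac n{14})-32\sigma(\tfrac n{56})+64W_{(1,14)}(n)+1024W_{(1,14)}(\tfrac n4)-256\bigl(W_{(2,7)}(\tfrac n2)+W_{(1,56)}(n)\bigr),$$ $$N_{(2,7)}(n)=8\sigma(\tfrac n2)-32\sigma(\tfrac n8)+8\sigma(\tfrac n7)-32\sigma(\tfrac n{28})+64W_{(2,7)}(n)+1024W_{(2,7)}(\tfrac n4)-256\bigl(W_{(7,8)}(n)+W_{(1,14)}(\tfrac n2)\bigr).$$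
   Context: $\mathbb{N}$ is the set of positive integers, $\mathbb{N}_0=\mathbb{N}\cup\{0\}$. $\sigma(n)=\sum_{0<d\mid n}d$ for $n\in\mathbb{N}$ and $\sigma(m)=0$ for $m\notin\mathbb{N}$. $W_{(r,s)}(n)=\sum_{(l,m)\in\mathbb{N}_0^2,\ rl+sm=n}\sigma(l)\sigma(m)$, which is $0$ if $n$ is not an integer. $N_{(a,b)}(n)$ is the number of $(x_1,\dots,x_8)\in\mathbb{Z}^8$ with $n=a(x_1^2+x_2^2+x_3^2+x_4^2)+b(x_5^2+x_6^2+x_7^2+x_8^2)$. *)

theory Defs
  imports Complex_Main
begin

text \<open>The arguments are rational, so that terms such as \<open>sigma (n / 4)\<close> make sense for every
  \<open>n\<close>; \<open>sigma x\<close> vanishes unless \<open>x\<close> is a positive integer, in particular at \<open>0\<close>.\<close>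

definition sigma :: "rat \<Rightarrow> int" where
  "sigma x = (if x \<in> \<nat> \<and> 0 < x then \<Sum>d | 0 < d \<and> d dvd \<lfloor>x\<rfloor>. d else 0)"

text \<open>For positive \<open>r\<close> and \<open>s\<close> the index set is finite; it is empty, and hence the sum is \<open>0\<close>,
  unless \<open>x\<close> is an integer.\<close>

definition W :: "nat \<Rightarrow> nat \<Rightarrow> rat \<Rightarrow> int" where
  "W r s x = (\<Sum>(l, m) \<in> {(l :: nat, m :: nat). of_nat r * of_nat l + of_nat s * of_nat m = x}.
     sigma (of_nat l) * sigma (of_nat m))"

text \<open>For positive \<open>a\<close> and \<open>b\<close> the counted set is finite.\<close>

definition N :: "nat \<Rightarrow> nat \<Rightarrow> nat \<Rightarrow> nat" where
  "N a b n = card {(x1 :: int, x2 :: int, x3 :: int, x4 :: int,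
                    x5 :: int, x6 :: int, x7 :: int, x8 :: int).
     int n = int a * (x1\<^sup>2 + x2\<^sup>2 + x3\<^sup>2 + x4\<^sup>2) + int b * (x5\<^sup>2 + x6\<^sup>2 + x7\<^sup>2 + x8\<^sup>2)}"

end

theory Submission
  imports Defs
begin

text \<open>The form \<open>a (x\<^sub>1\<^sup>2 + \<dots> + x\<^sub>4\<^sup>2) + b (x\<^sub>5\<^sup>2 + \<dots> + x\<^sub>8\<^sup>2)\<close> splits into two sums of four squares, so the
number of representations is the convolution \<open>\<Sum> r\<^sub>4(l) r\<^sub>4(m)\<close> over \<open>a l + b m = n\<close>
(\<open>N_eq_convolution\<close>).  Jacobi's theorem (\<open>jacobi_four_squares\<close>) says that
\<open>r\<^sub>4(m) = 8 \<sigma>(m) - 32 \<sigma>(m/4)\<close> for \<open>m > 0\<close>, while \<open>r\<^sub>4(0) = 1\<close>.  Multiplying out, the products with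
\<open>r\<^sub>4(0)\<close> give the single \<open>\<sigma>\<close> terms and the remaining products give the sums \<open>W\<close>
(\<open>N_formula\<close>); common factors of the two coefficients of \<open>W\<close> move into its argument.

The substance is Jacobi's theorem, proved here by elementary means.  Both sides are shown to satisfy
\<open>\<Sum>\<^sub>i (n - 5 i\<^sup>2) f(n - i\<^sup>2) = 0\<close> for \<open>n > 0\<close>, the sum being over all integers \<open>i\<close>.  Its term \<open>i = 0\<close>
is \<open>n f(n)\<close>, so \<open>f\<close> is determined by \<open>f(0)\<close>.  For \<open>f = r\<^sub>4\<close> the sum runs over the representations
\<open>n = i\<^sup>2 + x\<^sub>1\<^sup>2 + \<dots> + x\<^sub>4\<^sup>2\<close>, and all five squares have the same total by symmetry
(\<open>r4_recurrence\<close>).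

For the divisor side, \<open>8 \<sigma>(m) - 32 \<sigma>(m/4)\<close> is \<open>8 \<Sum> w(d, e) d\<close> over \<open>d e = m\<close>, where \<open>w\<close> is \<open>-1\<close> when
\<open>d\<close> and \<open>e\<close> are both even and \<open>1\<close> otherwise.  The recurrence thus concerns the sum of
\<open>w(d, e) (d e - 4 i\<^sup>2) d\<close> over the triples with \<open>i\<^sup>2 + d e = n\<close> and \<open>d, e > 0\<close>.  It is evaluated by a method
of Liouville: integral changes of variables preserving \<open>i\<^sup>2 + d e\<close> cancel or match all the triples
except those with \<open>2 i + d = e\<close> (\<open>weighted_triples_eq_diagonal\<close>).  For these
\<open>n = (i + d)\<^sup>2\<close>, so the sum vanishes unless \<open>n\<close> is a square; if \<open>n = s\<^sup>2\<close> it is \<open>n\<close>, which is exactly what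
offsets the terms \<open>i = \<plusminus>s\<close>, where \<open>f(0) = 1\<close>.\<close>

section \<open>A weighted divisor sum\<close>

text \<open>The sign depends only on whether \<open>d\<close> and \<open>e\<close> are both even, a condition that survives
exchanging \<open>d\<close> with \<open>e\<close> and adding to one of them an even number plus or minus the other.  Nothing
else happens to \<open>d\<close> and \<open>e\<close> in the changes of variables behind the recurrence.\<close>

definition parity_sign :: "int \<Rightarrow> int \<Rightarrow> int" where
  "parity_sign d e = (if even d \<and> even e then -1 else 1)"

lemma parity_sign_commute: "parity_sign d e = parity_sign e d"
  by (auto simp: parity_sign_def)

definition factor_pairs :: "int \<Rightarrow> (int \<times> int) set" where
  "factor_pairs m = {(d, e). 0 < d \<and> 0 < e \<and> d * e = m}"

definition jacobi_sum :: "int \<Rightarrow> int" where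
  "jacobi_sum m = (\<Sum>(d, e)\<in>factor_pairs m. parity_sign d e * d)"

lemma pos_mult_eq_bounds:
  fixes d e m :: int
  assumes "0 < d" "0 < e" "d * e = m"
  shows "1 \<le> d" "d \<le> m" "1 \<le> e" "e \<le> m"
proof -
  have "d * 1 \<le> d * e" "1 * e \<le> d * e"
    using assms(1,2) by (intro mult_left_mono mult_right_mono; simp)+
  then show "1 \<le> d" "d \<le> m" "1 \<le> e" "e \<le> m"
    using assms by auto
qed

lemma finite_factor_pairs: "finite (factor_pairs m)"
  by (rule finite_subset[of _ "{1..m} \<times> {1..m}"])
     (use pos_mult_eq_bounds in \<open>auto simp: factor_pairs_def\<close>)

lemma jacobi_sum_nonpos: "m \<le> 0 \<Longrightarrow> jacobi_sum m = 0"
proof -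
  assume "m \<le> 0"
  then have "factor_pairs m = {}"
    unfolding factor_pairs_def by (auto dest: mult_pos_pos)
  then show ?thesis
    by (simp add: jacobi_sum_def)
qed

lemma sigma_of_int:
  assumes "0 < m"
  shows "sigma (of_int m) = (\<Sum>(d, e)\<in>factor_pairs m. d)"
proof -
  have "(of_int m :: rat) \<in> \<nat>"
    using assms by (metis of_int_of_nat_eq of_nat_in_Nats zero_less_imp_eq_int)
  then have "sigma (of_int m) = (\<Sum>d | 0 < d \<and> d dvd m. d)"
    using assms by (simp add: sigma_def)
  also have "\<dots> = (\<Sum>(d, e)\<in>factor_pairs m. d)"
    by (rule sum.reindex_bij_witness[of _ fst "\<lambda>d. (d, m div d)"])
       (use assms in \<open>auto simp: factor_pairs_def pos_imp_zdiv_pos_iff zdvd_imp_le\<close>)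
  finally show ?thesis .
qed

lemma sigma_eq_0_if_not_dvd:
  assumes "0 < c" "\<not> c dvd m"
  shows "sigma (of_nat m / of_nat c) = 0"
proof -
  have "(of_nat m / of_nat c :: rat) \<notin> \<nat>"
  proof
    assume "(of_nat m / of_nat c :: rat) \<in> \<nat>"
    then obtain k where "(of_nat m / of_nat c :: rat) = of_nat k"
      by (auto elim: Nats_cases)
    then have "(of_nat m :: rat) = of_nat (c * k)"
      using assms(1) by (simp add: field_simps)
    then show False
      using assms(2) by (metis dvd_triv_left of_nat_eq_iff)
  qed
  then show ?thesis
    by (simp add: sigma_def)
qed

lemma sigma_0: "sigma 0 = 0"
  by (simp add: sigma_def)

text \<open>Changing the sign of the pairs with both entries even subtracts twice their sum, and halving both
entries turns these pairs into the factorisations of \<open>m / 4\<close>.\<close>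

lemma jacobi_sum_eq_sigma:
  "jacobi_sum (int m) = sigma (of_nat m) - 4 * sigma (of_nat m / 4)"
proof (cases "m = 0")
  case True
  then show ?thesis by (simp add: jacobi_sum_nonpos sigma_0)
next
  case False
  define E where "E = {(d, e) \<in> factor_pairs (int m). even d \<and> even e}"
  have "(\<Sum>(d, e)\<in>E. d) = 2 * sigma (of_nat m / 4)"
  proof (cases "4 dvd m")
    case True
    then obtain k where k: "m = 4 * k" ..
    have "(\<Sum>(d, e)\<in>E. d) = (\<Sum>(d, e)\<in>factor_pairs (int k). 2 * d)"
      by (rule sum.reindex_bij_witness[of _ "\<lambda>(d, e). (2 * d, 2 * e)" "\<lambda>(d, e). (d div 2, e div 2)"])
         (auto simp: E_def factor_pairs_def k elim!: evenE)
    also have "\<dots> = 2 * sigma (of_int (int k))"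
      using False k by (subst sigma_of_int) (auto simp: sum_distrib_left case_prod_unfold)
    finally show ?thesis
      by (simp add: k)
  next
    case nd: False
    have "E = {}"
    proof -
      have False if "d * e = int m" "even d" "even e" for d e
      proof -
        have "2 * 2 dvd d * e" using that(2,3) by (rule mult_dvd_mono)
        then have "int 4 dvd int m" using that(1) by simp
        then show False using nd by (simp only: int_dvd_int_iff)
      qed
      then show ?thesis by (auto simp: E_def factor_pairs_def)
    qed
    then show ?thesis
      using sigma_eq_0_if_not_dvd[of 4 m] nd by simp
  qed
  moreover have "jacobi_sum (int m) = (\<Sum>(d, e)\<in>factor_pairs (int m). d) - 2 * (\<Sum>(d, e)\<in>E. d)"
  proof -
    have E_sum: "(\<Sum>(d, e)\<in>E. d) = (\<Sum>(d, e)\<in>factor_pairs (int m). if even d \<and> even e then d else 0)"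
      unfolding E_def by (rule sum.mono_neutral_cong_left[OF finite_factor_pairs]) (auto split: if_splits)
    show ?thesis
      unfolding jacobi_sum_def E_sum sum_distrib_left sum_subtractf[symmetric]
      by (rule sum.cong) (auto simp: parity_sign_def)
  qed
  ultimately show ?thesis
    using False sigma_of_int[of "int m"] by simp
qed

section \<open>The recurrence for the divisor sum\<close>

definition triples :: "int \<Rightarrow> (int \<times> int \<times> int) set" where
  "triples n = {(i, d, e). 0 < d \<and> 0 < e \<and> i * i + d * e = n}"

lemma abs_le_square_int: "\<bar>x\<bar> \<le> x^2" for x :: int
  using mult_left_mono[of 1 "\<bar>x\<bar>" "\<bar>x\<bar>"] by (cases "x = 0") (auto simp: power2_eq_square)

lemma triples_Sigma:
  "triples n = (SIGMA i:{-n..n}. factor_pairs (n - i * i))"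
proof -
  have "\<bar>i\<bar> \<le> n" if "0 < d" "0 < e" "i * i + d * e = n" for i d e
  proof -
    have "0 < d * e"
      using that by simp
    then show ?thesis
      using that(3) abs_le_square_int[of i] unfolding power2_eq_square by linarith
  qed
  then show ?thesis
    unfolding triples_def factor_pairs_def by (force simp: abs_le_iff)
qed

lemma finite_triples: "finite (triples n)"
  unfolding triples_Sigma using finite_factor_pairs by auto

lemma sum_triples_negate:
  "(\<Sum>(i, d, e)\<in>triples n. f i d e) = (\<Sum>(i, d, e)\<in>triples n. f (-i) d e)"
  by (rule sum.reindex_bij_witness[of _ "\<lambda>(i, d, e). (-i, d, e)" "\<lambda>(i, d, e). (-i, d, e)"])
     (auto simp: triples_def)

lemma sum_triples_swap:
  "(\<Sum>(i, d, e)\<in>triples n. f i d e) = (\<Sum>(i, d, e)\<in>triples n. f i e d)"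
  by (rule sum.reindex_bij_witness[of _ "\<lambda>(i, d, e). (i, e, d)" "\<lambda>(i, d, e). (i, e, d)"])
     (auto simp: triples_def mult.commute)

lemma sum_trichotomy:
  fixes u v :: "'a \<Rightarrow> int" and f :: "'a \<Rightarrow> int"
  assumes "finite A"
  shows "sum f A = sum f {x \<in> A. u x < v x} + sum f {x \<in> A. u x = v x} + sum f {x \<in> A. v x < u x}"
proof -
  let ?L = "{x \<in> A. u x < v x}" and ?E = "{x \<in> A. u x = v x}" and ?G = "{x \<in> A. v x < u x}"
  have "sum f (?L \<union> ?E \<union> ?G) = sum f (?L \<union> ?E) + sum f ?G"
    by (rule sum.union_disjoint) (use assms in auto)
  also have "sum f (?L \<union> ?E) = sum f ?L + sum f ?E"
    by (rule sum.union_disjoint) (use assms in auto)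
  also have "?L \<union> ?E \<union> ?G = A"
    by auto
  finally show ?thesis .
qed

text \<open>The triples on which both changes of variables below degenerate, because the new value of \<open>d\<close> or
\<open>e\<close> would be \<open>0\<close>.\<close>

definition diagonal_triples :: "int \<Rightarrow> (int \<times> int \<times> int) set" where
  "diagonal_triples n = {(i, d, e) \<in> triples n. 2 * i + d = e}"

text \<open>The involution \<open>(i, d, e) \<mapsto> (e - i, 2 i + d - e, e)\<close> preserves \<open>i\<^sup>2 + d e\<close> and \<open>d + i\<close> and changes the sign of
\<open>e - 2 i\<close>; the inequality ensures that the new middle entry is positive.\<close>

lemma sum_shear_cancel:
  "(\<Sum>(i, d, e)\<in>{(i, d, e) \<in> triples n. e < 2 * i + d}. parity_sign d e * (e - 2 * i) * (d + i)^2) = 0"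
  (is "sum ?G ?A = 0")
proof -
  have "sum ?G ?A = sum (\<lambda>x. - ?G x) ?A"
    by (rule sum.reindex_bij_witness[of _ "\<lambda>(i, d, e). (e - i, 2 * i + d - e, e)"
          "\<lambda>(i, d, e). (e - i, 2 * i + d - e, e)"])
       (auto simp: triples_def parity_sign_def algebra_simps power2_eq_square)
  then show ?thesis
    by (simp add: sum_negf)
qed

text \<open>On the opposite side of the diagonal, the substitution \<open>(i, d, e) \<mapsto> (i + d, d, e - 2 i - d)\<close> preserves
\<open>i\<^sup>2 + d e\<close>.  In terms of the new triple, \<open>e - 2 i\<close> becomes \<open>d + e\<close> and \<open>d + i\<close> becomes \<open>i\<close>.\<close>

lemma sum_shear_transport:
  "(\<Sum>(i, d, e)\<in>{(i, d, e) \<in> triples n. 2 * i + d < e}. parity_sign d e * (e - 2 * i) * (d + i)^2)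
   = (\<Sum>(i, d, e)\<in>{(i, d, e) \<in> triples n. d < 2 * i + e}. parity_sign d e * (d + e) * i^2)"
  by (rule sum.reindex_bij_witness[of _ "\<lambda>(i, d, e). (i - d, d, e + 2 * i - d)"
        "\<lambda>(i, d, e). (i + d, d, e - 2 * i - d)"])
     (auto simp: triples_def parity_sign_def algebra_simps)

text \<open>The map \<open>(i, d, e) \<mapsto> (-i, e, d)\<close> exchanges \<open>d < 2 i + e\<close> with \<open>d > 2 i + e\<close> and fixes the summand, so each of
these two ranges carries half of what lies off the set \<open>d = 2 i + e\<close>, the mirror image of the
diagonal.\<close>

lemma twice_sum_half:
  "2 * (\<Sum>(i, d, e)\<in>{(i, d, e) \<in> triples n. d < 2 * i + e}. parity_sign d e * (d + e) * i^2)
   = (\<Sum>(i, d, e)\<in>triples n. parity_sign d e * (d + e) * i^2)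
     - (\<Sum>(i, d, e)\<in>diagonal_triples n. parity_sign d e * (d + e) * i^2)"
proof -
  let ?f = "\<lambda>(i, d, e). parity_sign d e * (d + e) * i^2"
  let ?u = "\<lambda>(i, d, e). d" and ?v = "\<lambda>(i, d, e). 2 * i + e"
  have set_eq: "{x \<in> triples n. R (?u x) (?v x)} = {(i, d, e) \<in> triples n. R d (2 * i + e)}"
    for R :: "int \<Rightarrow> int \<Rightarrow> bool"
    by auto
  have "sum ?f {(i, d, e) \<in> triples n. 2 * i + e < d} = sum ?f {(i, d, e) \<in> triples n. d < 2 * i + e}"
    by (rule sum.reindex_bij_witness[of _ "\<lambda>(i, d, e). (-i, e, d)" "\<lambda>(i, d, e). (-i, e, d)"])
       (auto simp: triples_def parity_sign_def algebra_simps)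
  moreover have "sum ?f {(i, d, e) \<in> triples n. d = 2 * i + e} = sum ?f (diagonal_triples n)"
    by (rule sum.reindex_bij_witness[of _ "\<lambda>(i, d, e). (i, e, d)" "\<lambda>(i, d, e). (i, e, d)"])
       (auto simp: diagonal_triples_def triples_def parity_sign_def algebra_simps)
  ultimately show ?thesis
    using sum_trichotomy[OF finite_triples, of ?f n ?u ?v]
      set_eq[of "(<)"] set_eq[of "(=)"] set_eq[of "(>)"] by simp
qed

text \<open>Terms odd in \<open>i\<close> cancel under \<open>i \<mapsto> -i\<close>, and in the term \<open>e i\<^sup>2\<close> the letters \<open>d\<close> and \<open>e\<close> may be exchanged.
The weight \<open>(e - 2 i) (d + i)\<^sup>2\<close> is chosen so that, apart from \<open>d i\<^sup>2\<close>, precisely the summand of the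
recurrence remains.\<close>

lemma sum_triples_expand:
  "(\<Sum>(i, d, e)\<in>triples n. parity_sign d e * (e - 2 * i) * (d + i)^2)
   = (\<Sum>(i, d, e)\<in>triples n. parity_sign d e * (d * e - 4 * i^2) * d)
     + (\<Sum>(i, d, e)\<in>triples n. parity_sign d e * d * i^2)"
proof -
  \<comment> \<open>the part of the expanded weight that is odd in \<open>i\<close>\<close>
  let ?odd = "\<lambda>i d e. parity_sign d e * (2 * d * e * i - 2 * i * d^2 - 2 * i^3)"
  have "(\<Sum>(i, d, e)\<in>triples n. ?odd i d e) = (\<Sum>(i, d, e)\<in>triples n. - ?odd i d e)"
    by (subst sum_triples_negate) (auto intro!: sum.cong simp: algebra_simps)
  then have odd: "(\<Sum>(i, d, e)\<in>triples n. ?odd i d e) = 0"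
    by (simp add: case_prod_unfold sum_negf)
  have "(\<Sum>(i, d, e)\<in>triples n. parity_sign d e * (e - 2 * i) * (d + i)^2)
      = (\<Sum>(i, d, e)\<in>triples n. parity_sign d e * (d * e - 4 * i^2) * d)
       + (\<Sum>(i, d, e)\<in>triples n. parity_sign d e * e * i^2)
       + (\<Sum>(i, d, e)\<in>triples n. ?odd i d e)"
    unfolding sum.distrib[symmetric]
    by (rule sum.cong) (auto simp: algebra_simps power2_eq_square power3_eq_cube)
  also have "(\<Sum>(i, d, e)\<in>triples n. parity_sign d e * e * i^2)
      = (\<Sum>(i, d, e)\<in>triples n. parity_sign d e * d * i^2)"
    by (subst sum_triples_swap) (simp add: parity_sign_commute)
  finally show ?thesis
    using odd by simp
qed

text \<open>By the preceding cancellation and transport, the sum of \<open>w (e - 2 i) (d + i)\<^sup>2\<close> over all triples is its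
diagonal part plus half of the off-diagonal sum of \<open>w (d + e) i\<^sup>2\<close>.  The full sum of the latter is twice the
sum of \<open>w d i\<^sup>2\<close>, which cancels against the surplus in the expansion.\<close>

lemma weighted_triples_eq_diagonal:
  "2 * (\<Sum>(i, d, e)\<in>triples n. parity_sign d e * (d * e - 4 * i^2) * d)
   = (\<Sum>(i, d, e)\<in>diagonal_triples n. parity_sign d e * (2 * d * (d + i)^2 - (d + e) * i^2))"
proof -
  let ?G = "\<lambda>(i, d, e). parity_sign d e * (e - 2 * i) * (d + i)^2"
  let ?H = "\<lambda>(i, d, e). parity_sign d e * (d + e) * i^2"
  let ?v = "\<lambda>(i, d, e). 2 * i + d" and ?u = "\<lambda>(i, d, e). e"
  have set_eq: "{x \<in> triples n. R (?u x) (?v x)} = {(i, d, e) \<in> triples n. R e (2 * i + d)}"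
    for R :: "int \<Rightarrow> int \<Rightarrow> bool"
    by auto
  have diag_eq: "{(i, d, e) \<in> triples n. e = 2 * i + d} = diagonal_triples n"
    by (auto simp: diagonal_triples_def)
  have "sum ?G (triples n) = sum ?G (diagonal_triples n)
      + sum ?H {(i, d, e) \<in> triples n. d < 2 * i + e}"
    using sum_trichotomy[OF finite_triples, of ?G n ?u ?v] sum_shear_cancel[of n]
      sum_shear_transport[of n] set_eq[of "(<)"] set_eq[of "(=)"] set_eq[of "(>)"] diag_eq
    by simp
  moreover have "sum ?H (triples n) = 2 * (\<Sum>(i, d, e)\<in>triples n. parity_sign d e * d * i^2)"
  proof -
    have "sum ?H (triples n) = (\<Sum>(i, d, e)\<in>triples n. parity_sign d e * d * i^2)
      + (\<Sum>(i, d, e)\<in>triples n. parity_sign d e * e * i^2)"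
      unfolding sum.distrib[symmetric] by (rule sum.cong) (auto simp: algebra_simps)
    also have "(\<Sum>(i, d, e)\<in>triples n. parity_sign d e * e * i^2)
      = (\<Sum>(i, d, e)\<in>triples n. parity_sign d e * d * i^2)"
      by (subst sum_triples_swap) (simp add: parity_sign_commute)
    finally show ?thesis by simp
  qed
  ultimately have "2 * (\<Sum>(i, d, e)\<in>triples n. parity_sign d e * (d * e - 4 * i^2) * d)
    = 2 * sum ?G (diagonal_triples n) - sum ?H (diagonal_triples n)"
    using twice_sum_half[of n] sum_triples_expand[of n] by simp
  also have "\<dots> = (\<Sum>(i, d, e)\<in>diagonal_triples n. parity_sign d e * (2 * d * (d + i)^2 - (d + e) * i^2))"
    unfolding sum_distrib_left sum_subtractf[symmetric]
    by (rule sum.cong) (auto simp: diagonal_triples_def algebra_simps)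
  finally show ?thesis .
qed

text \<open>Passing from \<open>s\<close> to \<open>s + 1\<close> flips every sign and increases every \<open>s\<^sup>2 - i\<^sup>2\<close> by \<open>2 s + 1\<close>; since the signs
alone add up to \<open>\<plusminus>1\<close>, two consecutive values have the sum \<open>2 s + 1\<close>.\<close>

lemma alternating_sum_squares:
  "(\<Sum>i\<in>{- int s..int s}. (if even (int s - i) then -1 else 1) * ((int s)^2 - i^2)) = int s"
proof (induction s)
  case 0
  then show ?case by simp
next
  case (Suc s)
  let ?t = "int s"
  have split: "(\<Sum>i\<in>{- int (Suc s)..int (Suc s)}. f i)
      = (\<Sum>i\<in>{- int s..int s}. f i) + f (- int (Suc s)) + f (int (Suc s))" for f :: "int \<Rightarrow> int" and s
  proof -
    have "{- int (Suc s)..int (Suc s)} = insert (- int (Suc s)) (insert (int (Suc s)) {- int s..int s})"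
      by auto
    then show ?thesis by (simp add: add.commute add.left_commute)
  qed
  have alt: "(\<Sum>i\<in>{- int s..int s}. if even (int s - i) then 1 else -1) = (1::int)" for s
  proof (induction s)
    case (Suc s)
    have "(\<Sum>i\<in>{- int s..int s}. if even (int (Suc s) - i) then 1 else -1)
      = - (\<Sum>i\<in>{- int s..int s}. if even (int s - i) then 1 else (-1::int))"
      unfolding sum_negf[symmetric] by (rule sum.cong) auto
    then show ?case using Suc.IH by (subst split) simp
  qed simp
  have "(\<Sum>i\<in>{- ?t..?t}. (if even (int (Suc s) - i) then -1 else 1) * ((int (Suc s))^2 - i^2))
      = (2 * ?t + 1) * (\<Sum>i\<in>{- ?t..?t}. if even (?t - i) then 1 else -1)
        - (\<Sum>i\<in>{- ?t..?t}. (if even (?t - i) then -1 else 1) * (?t^2 - i^2))"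
    unfolding sum_distrib_left sum_subtractf[symmetric]
    by (rule sum.cong) (auto simp: algebra_simps power2_eq_square)
  also have "\<dots> = int (Suc s)"
    unfolding alt Suc.IH by simp
  finally show ?case
    by (subst split) (simp add: power2_eq_square algebra_simps)
qed

text \<open>If \<open>e = 2 i + d\<close>, then \<open>i\<^sup>2 + d e = (i + d)\<^sup>2\<close>, and \<open>2 (i + d) = d + e\<close> is positive.\<close>

lemma diagonal_triples_square:
  fixes s :: nat
  assumes "0 < s"
  shows "diagonal_triples (int s * int s) = (\<lambda>i. (i, int s - i, int s + i)) ` {- int s<..<int s}"
proof -
  have sum_eq: "i + d = int s" if "0 < d" "0 < 2 * i + d" "i * i + d * (2 * i + d) = int s * int s" for i d
  proof -
    have "(i + d)^2 = (int s)^2"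
      using that(3) by (simp add: power2_eq_square algebra_simps)
    moreover have "0 \<le> i + d"
      using that(1,2) by linarith
    ultimately show ?thesis
      by (rule power2_eq_imp_eq) simp
  qed
  have "x \<in> (\<lambda>i. (i, int s - i, int s + i)) ` {- int s<..<int s}"
    if "x \<in> diagonal_triples (int s * int s)" for x
  proof -
    obtain i d e where x: "x = (i, d, e)"
      by (cases x)
    then have e: "e = 2 * i + d"
      and "0 < d" "0 < 2 * i + d" "i * i + d * (2 * i + d) = int s * int s"
      using that by (auto simp: diagonal_triples_def triples_def)
    moreover from this have "i + d = int s"
      by (rule_tac sum_eq)
    ultimately have "d = int s - i" "e = int s + i" "i \<in> {- int s<..<int s}"
      by auto
    then show ?thesis
      using x by blast
  qed
  moreover have "(i, int s - i, int s + i) \<in> diagonal_triples (int s * int s)"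
    if "i \<in> {- int s<..<int s}" for i
    using that by (simp add: diagonal_triples_def triples_def algebra_simps)
  ultimately show ?thesis
    by blast
qed

lemma diagonal_triples_nonsquare:
  assumes "diagonal_triples n \<noteq> {}"
  obtains s :: nat where "0 < s" "n = int s * int s"
proof -
  from assms obtain i d where *: "0 < d" "0 < 2 * i + d" "i * i + d * (2 * i + d) = n"
    by (auto simp: diagonal_triples_def triples_def)
  then have "0 < i + d" "n = (i + d) * (i + d)"
    by (linarith, simp add: algebra_simps)
  then show thesis
    using that[of "nat (i + d)"] by simp
qed

text \<open>On the diagonal \<open>d = s - i\<close> and \<open>e = s + i\<close> have the same parity, so the sign is that of \<open>s - i\<close> and
the sum becomes one over \<open>|i| < s\<close>, in which the part linear in \<open>i\<close> drops out.\<close>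

lemma weighted_triples_square:
  fixes s :: nat
  assumes "0 < s"
  shows "(\<Sum>(i, d, e)\<in>triples (int s * int s). parity_sign d e * (d * e - 4 * i^2) * d) = int s * int s"
proof -
  let ?s = "int s" and ?c = "\<lambda>i. (if even (int s - i) then -1 else 1) :: int"
  let ?I = "{- int s<..<int s}"
  have "2 * (\<Sum>(i, d, e)\<in>triples (?s * ?s). parity_sign d e * (d * e - 4 * i^2) * d)
     = (\<Sum>i\<in>?I. ?c i * (2 * (?s - i) * ?s^2 - 2 * ?s * i^2))"
    unfolding weighted_triples_eq_diagonal diagonal_triples_square[OF assms]
    by (subst sum.reindex) (auto simp: inj_on_def parity_sign_def intro!: sum.cong)
  also have "\<dots> = 2 * ?s * (\<Sum>i\<in>?I. ?c i * (?s^2 - i^2)) - 2 * ?s^2 * (\<Sum>i\<in>?I. ?c i * i)"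
    unfolding sum_distrib_left sum_subtractf[symmetric]
    by (rule sum.cong) (auto simp: algebra_simps power2_eq_square)
  also have "(\<Sum>i\<in>?I. ?c i * i) = 0"
  proof -
    have "(\<Sum>i\<in>?I. ?c i * i) = (\<Sum>i\<in>?I. - (?c i * i))"
      by (rule sum.reindex_bij_witness[of _ uminus uminus]) auto
    then show ?thesis by (simp add: sum_negf)
  qed
  also have "(\<Sum>i\<in>?I. ?c i * (?s^2 - i^2)) = (\<Sum>i\<in>{- ?s..?s}. ?c i * (?s^2 - i^2))"
    by (rule sum.mono_neutral_left) (auto simp: not_less intro!: antisym)
  also have "\<dots> = ?s"
    by (rule alternating_sum_squares)
  finally show ?thesis by simp
qed

lemma weighted_triples_nonsquare:
  assumes "\<nexists>s :: nat. 0 < s \<and> n = int s * int s"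
  shows "(\<Sum>(i, d, e)\<in>triples n. parity_sign d e * (d * e - 4 * i^2) * d) = 0"
proof -
  have "diagonal_triples n = {}"
    using assms diagonal_triples_nonsquare by metis
  then show ?thesis
    using weighted_triples_eq_diagonal[of n] by simp
qed

text \<open>If \<open>n = i\<^sup>2 + d e\<close>, then \<open>n - 5 i\<^sup>2 = d e - 4 i\<^sup>2\<close>.\<close>

lemma jacobi_sum_convolution:
  "(\<Sum>i\<in>{-n..n}. (n - 5 * i^2) * jacobi_sum (n - i * i))
   = (\<Sum>(i, d, e)\<in>triples n. parity_sign d e * (d * e - 4 * i^2) * d)"
proof -
  have "(\<Sum>(i, d, e)\<in>triples n. parity_sign d e * (d * e - 4 * i^2) * d)
    = (\<Sum>i\<in>{-n..n}. \<Sum>(d, e)\<in>factor_pairs (n - i * i). parity_sign d e * (d * e - 4 * i^2) * d)"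
    unfolding triples_Sigma using finite_factor_pairs
    by (subst sum.Sigma) (auto intro!: sum.cong)
  also have "\<dots> = (\<Sum>i\<in>{-n..n}. (n - 5 * i^2) * jacobi_sum (n - i * i))"
    unfolding jacobi_sum_def sum_distrib_left
    by (intro sum.cong refl) (auto simp: factor_pairs_def power2_eq_square algebra_simps)
  finally show ?thesis ..
qed

definition four_squares_formula :: "int \<Rightarrow> int" where
  "four_squares_formula m = (if m = 0 then 1 else 8 * jacobi_sum m)"

text \<open>The value \<open>1\<close> at \<open>0\<close> enters only through \<open>i\<^sup>2 = n\<close>, where the coefficient is \<open>n - 5 n = -4 n\<close>.  If
\<open>n\<close> is a positive square, this happens twice and contributes \<open>-8 n\<close>, against \<open>8 n\<close> from the divisor sums.\<close>

lemma four_squares_formula_recurrence: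
  assumes "0 < n"
  shows "(\<Sum>i\<in>{-n..n}. (n - 5 * i^2) * four_squares_formula (n - i * i)) = 0"
proof -
  \<comment> \<open>the indices at which the exceptional value at \<open>0\<close> is taken\<close>
  define R where "R = {i \<in> {-n..n}. i * i = n}"
  have "(\<Sum>i\<in>{-n..n}. (n - 5 * i^2) * four_squares_formula (n - i * i))
     = 8 * (\<Sum>i\<in>{-n..n}. (n - 5 * i^2) * jacobi_sum (n - i * i))
       + (\<Sum>i\<in>{-n..n}. if i * i = n then - 4 * n else 0)"
    unfolding sum_distrib_left sum.distrib[symmetric]
    by (rule sum.cong) (auto simp: four_squares_formula_def jacobi_sum_nonpos power2_eq_square)
  also have "(\<Sum>i\<in>{-n..n}. if i * i = n then - 4 * n else 0) = - 4 * n * int (card R)"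
    unfolding R_def by (simp add: sum.If_cases Int_def mult.commute)
  finally have eq: "(\<Sum>i\<in>{-n..n}. (n - 5 * i^2) * four_squares_formula (n - i * i))
     = 8 * (\<Sum>i\<in>{-n..n}. (n - 5 * i^2) * jacobi_sum (n - i * i)) - 4 * n * int (card R)"
    by simp
  show ?thesis
  proof (cases "\<exists>s :: nat. 0 < s \<and> n = int s * int s")
    case True
    then obtain s :: nat where s: "0 < s" "n = int s * int s" by auto
    have "R = {int s, - int s}"
    proof -
      have "int s * 1 \<le> int s * int s"
        using s(1) by (intro mult_left_mono) auto
      then have "int s \<le> n" using s(2) by simp
      then show ?thesis
        unfolding R_def s(2) by (auto simp: square_eq_iff)
    qed
    then have "card R = 2" using s(1) by simp
    then show ?thesis
      using eq weighted_triples_square[OF s(1)] by (simp add: jacobi_sum_convolution s(2))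
  next
    case False
    have "R = {}"
    proof -
      have False if "i * i = n" for i
        using False assms that by (metis abs_mult_self_eq mult_zero_left nat_0_le abs_ge_zero
            less_irrefl of_nat_0_less_iff zero_less_abs_iff)
      then show ?thesis by (auto simp: R_def)
    qed
    then show ?thesis
      using eq weighted_triples_nonsquare[OF False] by (simp add: jacobi_sum_convolution)
  qed
qed

section \<open>Jacobi's four squares theorem\<close>

definition quads :: "int \<Rightarrow> (int \<times> int \<times> int \<times> int) set" where
  "quads m = {(a, b, c, d). a^2 + b^2 + c^2 + d^2 = m}"

definition r4 :: "int \<Rightarrow> int" where
  "r4 m = int (card (quads m))"

lemma finite_quads: "finite (quads m)"
proof (rule finite_subset)
  show "quads m \<subseteq> {-m..m} \<times> {-m..m} \<times> {-m..m} \<times> {-m..m}"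
  proof
    fix x assume "x \<in> quads m"
    then obtain a b c d where x: "x = (a, b, c, d)" "a^2 + b^2 + c^2 + d^2 = m"
      by (auto simp: quads_def)
    have "\<bar>a\<bar> \<le> m" "\<bar>b\<bar> \<le> m" "\<bar>c\<bar> \<le> m" "\<bar>d\<bar> \<le> m"
      using x(2) abs_le_square_int[of a] abs_le_square_int[of b] abs_le_square_int[of c]
        abs_le_square_int[of d] zero_le_power2[of a] zero_le_power2[of b] zero_le_power2[of c]
        zero_le_power2[of d] by linarith+
    then show "x \<in> {-m..m} \<times> {-m..m} \<times> {-m..m} \<times> {-m..m}"
      by (auto simp: x(1) abs_le_iff)
  qed
qed auto

lemma quads_neg: "m < 0 \<Longrightarrow> quads m = {}"
proof -
  assume "m < 0"
  have "0 \<le> a^2 + b^2 + c^2 + d^2" for a b c d :: int by simp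
  with \<open>m < 0\<close> show ?thesis by (auto simp: quads_def linorder_not_le[symmetric])
qed

lemma r4_0: "r4 0 = 1"
proof -
  have "x \<in> quads 0 \<longleftrightarrow> x = (0, 0, 0, 0)" for x
  proof -
    obtain a b c d where x: "x = (a, b, c, d)"
      by (cases x)
    have "a = 0 \<and> b = 0 \<and> c = 0 \<and> d = 0" if "a^2 + b^2 + c^2 + d^2 = 0"
      using that zero_le_power2[of a] zero_le_power2[of b] zero_le_power2[of c] zero_le_power2[of d]
      by (smt (verit) zero_less_power2)
    then show ?thesis
      by (auto simp: x quads_def)
  qed
  then have "quads 0 = {(0, 0, 0, 0)}"
    by blast
  then show ?thesis
    by (simp add: r4_def)
qed

text \<open>The sum counts the representations of \<open>n\<close> by five squares, each with weight \<open>n\<close> minus five times its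
first square.  By symmetry the total of the first squares is one fifth of the total of \<open>n\<close>.\<close>

lemma r4_recurrence:
  "(\<Sum>i\<in>{-n..n}. (n - 5 * i^2) * r4 (n - i * i)) = 0"
proof -
  define Q where "Q = {(i, a, b, c, d). i^2 + a^2 + b^2 + c^2 + d^2 = n}"
  have Q_Sigma: "Q = (SIGMA i:{-n..n}. quads (n - i * i))"
  proof -
    have "\<bar>i\<bar> \<le> n" if "i^2 + a^2 + b^2 + c^2 + d^2 = n" for i a b c d
      using that abs_le_square_int[of i] zero_le_power2[of a] zero_le_power2[of b]
        zero_le_power2[of c] zero_le_power2[of d] by linarith
    then show ?thesis
      unfolding Q_def quads_def by (force simp: abs_le_iff power2_eq_square)
  qed
  have fin: "finite Q"
    unfolding Q_Sigma using finite_quads by auto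
  have sym_a: "(\<Sum>(i, a, b, c, d)\<in>Q. a^2) = (\<Sum>(i, a, b, c, d)\<in>Q. i^2)"
    by (rule sum.reindex_bij_witness[of _ "\<lambda>(i, a, b, c, d). (a, i, b, c, d)" "\<lambda>(i, a, b, c, d). (a, i, b, c, d)"])
       (auto simp: Q_def)
  have sym_b: "(\<Sum>(i, a, b, c, d)\<in>Q. b^2) = (\<Sum>(i, a, b, c, d)\<in>Q. i^2)"
    by (rule sum.reindex_bij_witness[of _ "\<lambda>(i, a, b, c, d). (b, a, i, c, d)" "\<lambda>(i, a, b, c, d). (b, a, i, c, d)"])
       (auto simp: Q_def)
  have sym_c: "(\<Sum>(i, a, b, c, d)\<in>Q. c^2) = (\<Sum>(i, a, b, c, d)\<in>Q. i^2)"
    by (rule sum.reindex_bij_witness[of _ "\<lambda>(i, a, b, c, d). (c, a, b, i, d)" "\<lambda>(i, a, b, c, d). (c, a, b, i, d)"])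
       (auto simp: Q_def)
  have sym_d: "(\<Sum>(i, a, b, c, d)\<in>Q. d^2) = (\<Sum>(i, a, b, c, d)\<in>Q. i^2)"
    by (rule sum.reindex_bij_witness[of _ "\<lambda>(i, a, b, c, d). (d, a, b, c, i)" "\<lambda>(i, a, b, c, d). (d, a, b, c, i)"])
       (auto simp: Q_def)
  have "(\<Sum>i\<in>{-n..n}. (n - 5 * i^2) * r4 (n - i * i)) = (\<Sum>(i, a, b, c, d)\<in>Q. n - 5 * i^2)"
    unfolding Q_Sigma r4_def using finite_quads
    by (subst sum.Sigma[symmetric]) (auto simp: case_prod_unfold mult.commute)
  also have "\<dots> = (\<Sum>(i, a, b, c, d)\<in>Q. (i^2 + a^2 + b^2 + c^2 + d^2) - 5 * i^2)"
    by (rule sum.cong) (auto simp: Q_def)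
  also have "\<dots> = (\<Sum>(i, a, b, c, d)\<in>Q. i^2) + (\<Sum>(i, a, b, c, d)\<in>Q. a^2)
      + (\<Sum>(i, a, b, c, d)\<in>Q. b^2) + (\<Sum>(i, a, b, c, d)\<in>Q. c^2) + (\<Sum>(i, a, b, c, d)\<in>Q. d^2)
      - 5 * (\<Sum>(i, a, b, c, d)\<in>Q. i^2)"
    unfolding sum_distrib_left sum.distrib[symmetric] sum_subtractf[symmetric]
    by (rule sum.cong) auto
  also have "\<dots> = 0"
    unfolding sym_a sym_b sym_c sym_d by simp
  finally show ?thesis .
qed

text \<open>The difference of the two sides satisfies the same recurrence and vanishes at \<open>0\<close> and at negative
arguments.  By induction only the term \<open>i = 0\<close>, that is \<open>m\<close> times the difference at \<open>m\<close>, survives.\<close>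

theorem card_quads_eq_formula:
  "r4 (int m) = four_squares_formula (int m)"
proof (induction m rule: less_induct)
  case (less m)
  show ?case
  proof (cases "m = 0")
    case True
    then show ?thesis by (simp add: r4_0 four_squares_formula_def)
  next
    case False
    let ?n = "int m" and ?D = "\<lambda>k. r4 k - four_squares_formula k"
    have "?D (?n - i * i) = 0" if "i \<noteq> 0" for i
    proof (cases "?n - i * i < 0")
      case True
      then show ?thesis
        by (simp add: r4_def quads_neg four_squares_formula_def jacobi_sum_nonpos)
    next
      case nonneg: False
      have "0 < i * i" using that by (auto simp: zero_less_mult_iff linorder_neq_iff)
      then have "nat (?n - i * i) < m" "int (nat (?n - i * i)) = ?n - i * i"
        using nonneg by linarith+
      then show ?thesis using less.IH[of "nat (?n - i * i)"] by simp
    qed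
    then have "(\<Sum>i\<in>{-?n..?n}. (?n - 5 * i^2) * ?D (?n - i * i))
        = (\<Sum>i\<in>{0}. (?n - 5 * i^2) * ?D (?n - i * i))"
      by (intro sum.mono_neutral_right) auto
    moreover have "(\<Sum>i\<in>{-?n..?n}. (?n - 5 * i^2) * ?D (?n - i * i)) = 0"
      using r4_recurrence[of ?n] four_squares_formula_recurrence[of ?n] False
      by (simp add: right_diff_distrib sum_subtractf)
    ultimately show ?thesis
      using False by simp
  qed
qed

corollary jacobi_four_squares:
  "r4 (int m) = (if m = 0 then 1 else 0) + 8 * sigma (of_nat m) - 32 * sigma (of_nat m / 4)"
  unfolding card_quads_eq_formula four_squares_formula_def jacobi_sum_eq_sigma
  by (simp add: sigma_0)

section \<open>Convolution\<close>

definition linear_reps :: "nat \<Rightarrow> nat \<Rightarrow> nat \<Rightarrow> (nat \<times> nat) set" where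
  "linear_reps a b n = {(l, m). a * l + b * m = n}"

lemma finite_linear_reps:
  assumes "0 < a" "0 < b"
  shows "finite (linear_reps a b n)"
proof (rule finite_subset)
  have "l \<le> n \<and> m \<le> n" if "a * l + b * m = n" for l m
  proof -
    have "l \<le> a * l" "m \<le> b * m"
      using assms by simp_all
    then show ?thesis
      using that by linarith
  qed
  then show "linear_reps a b n \<subseteq> {..n} \<times> {..n}"
    by (auto simp: linear_reps_def)
qed simp

lemma W_of_nat:
  "W a b (of_nat n) = (\<Sum>(l, m)\<in>linear_reps a b n. sigma (of_nat l) * sigma (of_nat m))"
proof -
  have "(of_nat a * of_nat l + of_nat b * of_nat m = (of_nat n :: rat)) = (a * l + b * m = n)" for l m
    by (metis of_nat_add of_nat_eq_iff of_nat_mult)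
  then show ?thesis
    by (simp add: W_def linear_reps_def)
qed

lemma W_commute: "W a b x = W b a x"
  unfolding W_def
  by (rule sum.reindex_bij_witness[of _ "\<lambda>(l, m). (m, l)" "\<lambda>(l, m). (m, l)"])
     (auto simp: algebra_simps)

lemma W_scale:
  assumes "0 < k"
  shows "W (k * a) (k * b) x = W a b (x / of_nat k)"
proof -
  have "(of_nat (k * a) * of_nat l + of_nat (k * b) * of_nat m = x)
      = (of_nat a * of_nat l + of_nat b * of_nat m = x / of_nat k)" for l m
    using assms by (simp add: eq_divide_eq algebra_simps)
  then show ?thesis by (simp only: W_def)
qed

text \<open>Only multiples \<open>l\<close> of \<open>c\<close> and \<open>m\<close> of \<open>d\<close> contribute, and dividing these by \<open>c\<close> and \<open>d\<close> moves the factors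
into the coefficients of the linear form.\<close>

lemma sum_sigma_quotients:
  assumes "0 < a" "0 < b" "0 < c" "0 < d"
  shows "(\<Sum>(l, m)\<in>linear_reps a b n. sigma (of_nat l / of_nat c) * sigma (of_nat m / of_nat d))
    = W (c * a) (d * b) (of_nat n)"
proof -
  let ?f = "\<lambda>(l, m). sigma (of_nat l / of_nat c) * sigma (of_nat m / of_nat d)"
  let ?A = "{(l, m) \<in> linear_reps a b n. c dvd l \<and> d dvd m}"
  have dvd: "k dvd l" if "sigma (of_nat l / of_nat k) \<noteq> 0" "0 < k" for k l
    using that sigma_eq_0_if_not_dvd by blast
  have "sum ?f (linear_reps a b n) = sum ?f ?A"
    by (rule sum.mono_neutral_right[OF finite_linear_reps])
       (use assms in \<open>auto intro: dvd\<close>)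
  also have "\<dots> = W (c * a) (d * b) (of_nat n)"
    unfolding W_of_nat
    by (rule sum.reindex_bij_witness[of _ "\<lambda>(l, m). (c * l, d * m)" "\<lambda>(l, m). (l div c, m div d)"])
       (use assms in \<open>auto simp: linear_reps_def algebra_simps elim!: dvdE\<close>)
  finally show ?thesis .
qed

lemma sum_sigma_right_zero:
  assumes "0 < a" "0 < b" "0 < c"
  shows "(\<Sum>(l, m)\<in>linear_reps a b n. if m = 0 then sigma (of_nat l / of_nat c) else 0)
    = sigma (of_nat n / of_nat (c * a))"
proof -
  have "(\<Sum>(l, m)\<in>linear_reps a b n. if m = 0 then sigma (of_nat l / of_nat c) else 0)
     = (\<Sum>(l, m)\<in>{(l, m). m = (0::nat) \<and> a * l = n}. sigma (of_nat l / of_nat c))"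
    by (rule sum.mono_neutral_cong_right[OF finite_linear_reps])
       (use assms in \<open>auto simp: linear_reps_def split: if_splits\<close>)
  also have "\<dots> = sigma (of_nat n / of_nat (c * a))"
  proof (cases "a dvd n")
    case True
    then obtain k where k: "n = a * k" ..
    then have "{(l, m). m = (0::nat) \<and> a * l = n} = {(k, 0)}"
      using assms by auto
    then show ?thesis
      using assms by (simp add: k)
  next
    case False
    then have "\<not> c * a dvd n"
      using dvd_mult_right by blast
    then have "sigma (of_nat n / of_nat (c * a)) = 0"
      using assms by (intro sigma_eq_0_if_not_dvd) auto
    moreover have "{(l, m). m = (0::nat) \<and> a * l = n} = {}"
      using False by auto
    ultimately show ?thesis
      by (simp only: sum.empty)
  qed
  finally show ?thesis .
qed

lemma sum_sigma_left_zero: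
  assumes "0 < a" "0 < b" "0 < c"
  shows "(\<Sum>(l, m)\<in>linear_reps a b n. if l = 0 then sigma (of_nat m / of_nat c) else 0)
    = sigma (of_nat n / of_nat (c * b))"
  unfolding sum_sigma_right_zero[OF assms(2,1,3), symmetric]
  by (rule sum.reindex_bij_witness[of _ "\<lambda>(l, m). (m, l)" "\<lambda>(l, m). (m, l)"])
     (auto simp: linear_reps_def add.commute)

lemma N_eq_convolution:
  assumes "0 < a" "0 < b"
  shows "int (N a b n) = (\<Sum>(l, m)\<in>linear_reps a b n. r4 (int l) * r4 (int m))"
proof -
  define S where "S = (SIGMA p:linear_reps a b n. quads (int (fst p)) \<times> quads (int (snd p)))"
  define T where "T = {(x1 :: int, x2 :: int, x3 :: int, x4 :: int,
                    x5 :: int, x6 :: int, x7 :: int, x8 :: int).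
     int n = int a * (x1\<^sup>2 + x2\<^sup>2 + x3\<^sup>2 + x4\<^sup>2) + int b * (x5\<^sup>2 + x6\<^sup>2 + x7\<^sup>2 + x8\<^sup>2)}"
  let ?q = "\<lambda>x1 x2 x3 x4 :: int. x1\<^sup>2 + x2\<^sup>2 + x3\<^sup>2 + x4\<^sup>2"
  have rep: "a * nat (?q x1 x2 x3 x4) + b * nat (?q x5 x6 x7 x8) = n"
    if "int n = int a * ?q x1 x2 x3 x4 + int b * ?q x5 x6 x7 x8" for x1 x2 x3 x4 x5 x6 x7 x8
  proof -
    have "int (a * nat (?q x1 x2 x3 x4) + b * nat (?q x5 x6 x7 x8)) = int n"
      using that by simp
    then show ?thesis by (simp only: of_nat_eq_iff)
  qed
  have "bij_betw (\<lambda>(p, (x1, x2, x3, x4), (x5, x6, x7, x8)). (x1, x2, x3, x4, x5, x6, x7, x8)) S T"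
    by (rule bij_betw_byWitness[of _ "\<lambda>(x1, x2, x3, x4, x5, x6, x7, x8).
          ((nat (?q x1 x2 x3 x4), nat (?q x5 x6 x7 x8)), (x1, x2, x3, x4), (x5, x6, x7, x8))"])
       (auto simp: S_def T_def linear_reps_def quads_def rep simp flip: of_nat_mult of_nat_add)
  then have "N a b n = card S"
    unfolding N_def T_def by (simp add: bij_betw_same_card)
  also have "\<dots> = (\<Sum>p\<in>linear_reps a b n. card (quads (int (fst p))) * card (quads (int (snd p))))"
    unfolding S_def by (simp add: card_SigmaI finite_linear_reps assms finite_quads card_cartesian_product)
  finally show ?thesis
    by (simp add: r4_def case_prod_unfold)
qed

text \<open>Substituting Jacobi's formula into the convolution: for \<open>n > 0\<close> the pair \<open>(0, 0)\<close> is not among the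
solutions of \<open>a l + b m = n\<close>, so the product of the two values \<open>r\<^sub>4(0) = 1\<close> never occurs and each
remaining product is linear in the exceptional terms.\<close>

theorem N_formula:
  assumes "0 < a" "0 < b" "0 < n"
  shows "int (N a b n) =
    8 * sigma (of_nat n / of_nat a) - 32 * sigma (of_nat n / of_nat (4 * a))
    + 8 * sigma (of_nat n / of_nat b) - 32 * sigma (of_nat n / of_nat (4 * b))
    + 64 * W a b (of_nat n) + 1024 * W a b (of_nat n / 4)
    - 256 * (W (4 * a) b (of_nat n) + W a (4 * b) (of_nat n))"
proof -
  let ?P = "linear_reps a b n"
  let ?s = "\<lambda>c l. sigma (of_nat l / of_nat c)"
  have "r4 (int l) * r4 (int m) =
      8 * (if m = 0 then ?s 1 l else 0) - 32 * (if m = 0 then ?s 4 l else 0)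
      + 8 * (if l = 0 then ?s 1 m else 0) - 32 * (if l = 0 then ?s 4 m else 0)
      + 64 * (?s 1 l * ?s 1 m) + 1024 * (?s 4 l * ?s 4 m)
      - 256 * (?s 4 l * ?s 1 m) - 256 * (?s 1 l * ?s 4 m)" if "(l, m) \<in> ?P" for l m
  proof -
    have "\<not> (l = 0 \<and> m = 0)"
      using that assms(3) by (auto simp: linear_reps_def)
    then show ?thesis
      by (auto simp: jacobi_four_squares sigma_0 algebra_simps)
  qed
  then have "int (N a b n) = (\<Sum>(l, m)\<in>?P.
      8 * (if m = 0 then ?s 1 l else 0) - 32 * (if m = 0 then ?s 4 l else 0)
      + 8 * (if l = 0 then ?s 1 m else 0) - 32 * (if l = 0 then ?s 4 m else 0)
      + 64 * (?s 1 l * ?s 1 m) + 1024 * (?s 4 l * ?s 4 m)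
      - 256 * (?s 4 l * ?s 1 m) - 256 * (?s 1 l * ?s 4 m))"
    unfolding N_eq_convolution[OF assms(1,2)] by (intro sum.cong) auto
  also have "\<dots> =
      8 * (\<Sum>(l, m)\<in>?P. if m = 0 then ?s 1 l else 0) - 32 * (\<Sum>(l, m)\<in>?P. if m = 0 then ?s 4 l else 0)
      + 8 * (\<Sum>(l, m)\<in>?P. if l = 0 then ?s 1 m else 0) - 32 * (\<Sum>(l, m)\<in>?P. if l = 0 then ?s 4 m else 0)
      + 64 * (\<Sum>(l, m)\<in>?P. ?s 1 l * ?s 1 m) + 1024 * (\<Sum>(l, m)\<in>?P. ?s 4 l * ?s 4 m)
      - 256 * (\<Sum>(l, m)\<in>?P. ?s 4 l * ?s 1 m) - 256 * (\<Sum>(l, m)\<in>?P. ?s 1 l * ?s 4 m)"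
    unfolding case_prod_unfold sum_distrib_left sum.distrib sum_subtractf ..
  also have "\<dots> =
      8 * sigma (of_nat n / of_nat (1 * a)) - 32 * sigma (of_nat n / of_nat (4 * a))
      + 8 * sigma (of_nat n / of_nat (1 * b)) - 32 * sigma (of_nat n / of_nat (4 * b))
      + 64 * W (1 * a) (1 * b) (of_nat n) + 1024 * W (4 * a) (4 * b) (of_nat n)
      - 256 * W (4 * a) (1 * b) (of_nat n) - 256 * W (1 * a) (4 * b) (of_nat n)"
    using assms by (simp only: sum_sigma_right_zero sum_sigma_left_zero sum_sigma_quotients zero_less_one
        zero_less_numeral)
  finally show ?thesis
    by (simp add: W_scale[of 4 a b])
qed

theorem corollary7p2:
  fixes n :: nat
  assumes "0 < n"
  shows "int (N 1 10 n) =
           8 * sigma (of_nat n) - 32 * sigma (of_nat n / 4) + 8 * sigma (of_nat n / 10) - 32 * sigma (of_nat n / 40)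
           + 64 * W 1 10 (of_nat n) + 1024 * W 1 10 (of_nat n / 4)
           - 256 * (W 2 5 (of_nat n / 2) + W 1 40 (of_nat n))
       \<and> int (N 2 5 n) =
           8 * sigma (of_nat n / 2) - 32 * sigma (of_nat n / 8) + 8 * sigma (of_nat n / 5) - 32 * sigma (of_nat n / 20)
           + 64 * W 2 5 (of_nat n) + 1024 * W 2 5 (of_nat n / 4)
           - 256 * (W 5 8 (of_nat n) + W 1 10 (of_nat n / 2))
       \<and> int (N 1 14 n) =
           8 * sigma (of_nat n) - 32 * sigma (of_nat n / 4) + 8 * sigma (of_nat n / 14) - 32 * sigma (of_nat n / 56)
           + 64 * W 1 14 (of_nat n) + 1024 * W 1 14 (of_nat n / 4)
           - 256 * (W 2 7 (of_nat n / 2) + W 1 56 (of_nat n))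
       \<and> int (N 2 7 n) =
           8 * sigma (of_nat n / 2) - 32 * sigma (of_nat n / 8) + 8 * sigma (of_nat n / 7) - 32 * sigma (of_nat n / 28)
           + 64 * W 2 7 (of_nat n) + 1024 * W 2 7 (of_nat n / 4)
           - 256 * (W 7 8 (of_nat n) + W 1 14 (of_nat n / 2))"
proof -
  have "W 4 10 (of_nat n) = W 2 5 (of_nat n / 2)" "W 2 20 (of_nat n) = W 1 10 (of_nat n / 2)"
    "W 4 14 (of_nat n) = W 2 7 (of_nat n / 2)" "W 2 28 (of_nat n) = W 1 14 (of_nat n / 2)"
    using W_scale[of 2 2 5 "of_nat n"] W_scale[of 2 1 10 "of_nat n"]
      W_scale[of 2 2 7 "of_nat n"] W_scale[of 2 1 14 "of_nat n"] by simp_all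
  note W_eqs = this W_commute[of 8 5] W_commute[of 8 7]
  show ?thesis
  proof (intro conjI, goal_cases)
    case 1
    show ?case using N_formula[of 1 10 n] assms by (simp add: W_eqs)
  next
    case 2
    show ?case using N_formula[of 2 5 n] assms by (simp add: W_eqs)
  next
    case 3
    show ?case using N_formula[of 1 14 n] assms by (simp add: W_eqs)
  next
    case 4
    show ?case using N_formula[of 2 7 n] assms by (simp add: W_eqs)
  qed
qed

end
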